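(* Let $(\mathcal{C},T,C,\Phi,\overline B,\overline{\mathrm{eval}},\succeq_B)$ be a target–context category with behaviors, with ambient imitation relation $\succeq$. Then there is a target–context category with intrinsic behaviors $(\mathcal{C},T,C,\Phi,B_{\rm intr},\mathrm{eval}_{\rm intr},\succeq_B')$ — with the same category $\mathcal{C}$, objects $T,C$ and functor $\Phi$ — whose ambient imitation relation $\succeq'$ satisfies, for all objects $A$ and all $f,g\colon A\to T\otimes C$, $$f\succeq' g\implies f\succeq g.$$
   Context: A gs-monoidal category is a symmetric monoidal category (tensor $\otimes$, unit $I$) whose objects carry commutative comonoids $\mathrm{copy}_A\colon A\to A\otimes A$, $\mathrm{del}_A\colon A\to I$ compatible with $\otimes$, $\mathrm{del}_I=\mathrm{id}_I$. For $f\colon A\to X$: $\mathrm{dom}(f)=(\mathrm{id}_A\otimes(\mathrm{del}_X\circ f))\circ\mathrm{copy}_A$; normalized: $f\circ\mathrm{dom}(f)=f$. $\mathbf{Rel}$ is the category of sets and relations with cartesian product. A lax gs-monoidal functor $\Phi\colon\mathcal{C}\to\mathbf{Rel}$ is a lax symmetric monoidal functor whose structure maps $\psi_0,\psi_{A,B}$ satisfy $\Phi(\mathrm{copy}_A)=\psi_{A,A}\circ\mathrm{copy}_{\Phi A}$, $\Phi(\mathrm{del}_A)=\psi_0\circ\mathrm{del}_{\Phi A}$; $\overline X=\Phi(X)$, $\overline f=\Phi(f)$. Imitation: for a preordered set $(X,\succeq_X)$ and relations $\nu,\mu\colon A\to X$, $\nu\succeq^{\rm im}\mu$ iff for every $a$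 with $\mu(a)\ne\emptyset$ there are functions $\mathrm{enh}\colon\mu(a)\to\nu(a)$ with $\mathrm{enh}(u)\succeq_X u$ and $\mathrm{deg}\colon\nu(a)\to\mu(a)$ with $v\succeq_X\mathrm{deg}(v)$. A target–context category with behaviors $(\mathcal{C},T,C,\Phi,\overline B,\overline{\mathrm{eval}},\succeq_B)$: $\mathcal{C}$ a gs-monoidal category with all morphisms normalized, objects $T,C$, a lax gs-monoidal functor $\Phi\colon\mathcal{C}\to\mathbf{Rel}$, a set $\overline B$ with preorder $\succeq_B$, and a function $\overline{\mathrm{eval}}\colon\overline{T\otimes C}\to\overline B$; its ambient imitation relation on $\mathcal{C}(A,T\otimes C)$ is $f\succeq g$ iff $\overline{\mathrm{eval}}\circ\overline f\succeq^{\rm im}\overline{\mathrm{eval}}\circ\overline g$, and it is required that $f\circ\mathrm{dom}(g)=g\Rightarrow f\succeq g$ and $f\succeq g\Rightarrow f\circ h\succeq g\circ h$. It has intrinsic behaviors if $\overline B=\Phi(B)$ and $\overline{\mathrm{eval}}=\Phi(\mathrm{eval})$ for some object $B$ and morphism $\mathrm{eval}\colon T\otimes C\to B$ of $\mathcal{C}$. *)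

theory Defs
  imports Main "HOL-Library.FuncSet"
begin

section \<open>gs-monoidal categories\<close>

text \<open>
  The monoidal structure is not assumed to be strict. Arrows determine their source and target;
  composition \<open>g \<cdot> f\<close> is in applicative order and only meaningful for composable arrows.
  Objects and arrows are the elements of carrier sets in arbitrary types; behaviour of the
  operations outside the carriers is irrelevant.
  \<open>Assoc A B D : (A \<otimes> B) \<otimes> D \<rightarrow> A \<otimes> (B \<otimes> D)\<close>, \<open>Lun A : I \<otimes> A \<rightarrow> A\<close>, \<open>Run A : A \<otimes> I \<rightarrow> A\<close>,
  \<open>Braid A B : A \<otimes> B \<rightarrow> B \<otimes> A\<close>.
\<close>

record ('o, 'm) gs_structure =
  Obj   :: "'o set"
  Arr   :: "'m set"
  Src   :: "'m \<Rightarrow> 'o"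
  Tgt   :: "'m \<Rightarrow> 'o"
  Idt   :: "'o \<Rightarrow> 'm"
  Cmp   :: "'m \<Rightarrow> 'm \<Rightarrow> 'm"  (infixr \<open>\<cdot>\<index>\<close> 55)
  TenO  :: "'o \<Rightarrow> 'o \<Rightarrow> 'o"  (infixr \<open>\<otimes>\<^sub>o\<index>\<close> 65)
  TenA  :: "'m \<Rightarrow> 'm \<Rightarrow> 'm"  (infixr \<open>\<otimes>\<index>\<close> 65)
  Unt   :: "'o"              (\<open>\<I>\<index>\<close>)
  Assoc :: "'o \<Rightarrow> 'o \<Rightarrow> 'o \<Rightarrow> 'm"
  Lun   :: "'o \<Rightarrow> 'm"
  Run   :: "'o \<Rightarrow> 'm"
  Braid :: "'o \<Rightarrow> 'o \<Rightarrow> 'm"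
  Copy  :: "'o \<Rightarrow> 'm"
  Del   :: "'o \<Rightarrow> 'm"

definition hom :: "('o, 'm, 'x) gs_structure_scheme \<Rightarrow> 'o \<Rightarrow> 'o \<Rightarrow> 'm set" where
  "hom C A B = {f \<in> Arr C. Src C f = A \<and> Tgt C f = B}"

definition inverses :: "('o, 'm, 'x) gs_structure_scheme \<Rightarrow> 'm \<Rightarrow> 'm \<Rightarrow> bool" where
  "inverses C f g \<longleftrightarrow> f \<in> Arr C \<and> g \<in> hom C (Tgt C f) (Src C f)
     \<and> Cmp C g f = Idt C (Src C f) \<and> Cmp C f g = Idt C (Tgt C f)"

definition isomorphism :: "('o, 'm, 'x) gs_structure_scheme \<Rightarrow> 'm \<Rightarrow> bool" where
  "isomorphism C f \<longleftrightarrow> (\<exists>g. inverses C f g)"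

definition inverse_arrow :: "('o, 'm, 'x) gs_structure_scheme \<Rightarrow> 'm \<Rightarrow> 'm" where
  "inverse_arrow C f = (THE g. inverses C f g)"

text \<open>
  The canonical middle interchange
  \<open>(A \<otimes> A') \<otimes> (B \<otimes> B') \<rightarrow> (A \<otimes> B) \<otimes> (A' \<otimes> B')\<close>, i.e. \<open>id \<otimes> braid \<otimes> id\<close> up to associators.
\<close>

definition interchange ::
    "('o, 'm, 'x) gs_structure_scheme \<Rightarrow> 'o \<Rightarrow> 'o \<Rightarrow> 'o \<Rightarrow> 'o \<Rightarrow> 'm" where
  "interchange C A A' B B' =
     Cmp C (inverse_arrow C (Assoc C A B (TenO C A' B')))
    (Cmp C (TenA C (Idt C A) (Assoc C B A' B'))
    (Cmp C (TenA C (Idt C A) (TenA C (Braid C A' B) (Idt C B')))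
    (Cmp C (TenA C (Idt C A) (inverse_arrow C (Assoc C A' B B')))
           (Assoc C A A' (TenO C B B')))))"

locale category =
  fixes C :: "('o, 'm, 'x) gs_structure_scheme" (structure)
  assumes Src_Obj: "f \<in> Arr C \<Longrightarrow> Src C f \<in> Obj C"
    and Tgt_Obj: "f \<in> Arr C \<Longrightarrow> Tgt C f \<in> Obj C"
    and Idt_hom: "A \<in> Obj C \<Longrightarrow> Idt C A \<in> hom C A A"
    and Cmp_hom: "\<lbrakk>f \<in> hom C A B; g \<in> hom C B D\<rbrakk> \<Longrightarrow> g \<cdot> f \<in> hom C A D"
    and Cmp_Idt_left: "f \<in> hom C A B \<Longrightarrow> Idt C B \<cdot> f = f"
    and Cmp_Idt_right: "f \<in> hom C A B \<Longrightarrow> f \<cdot> Idt C A = f"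
    and Cmp_assoc: "\<lbrakk>f \<in> hom C A B; g \<in> hom C B D; h \<in> hom C D E\<rbrakk>
          \<Longrightarrow> (h \<cdot> g) \<cdot> f = h \<cdot> (g \<cdot> f)"

locale symmetric_monoidal_category = category +
  assumes Unt_Obj: "\<I> \<in> Obj C"
    and TenO_Obj: "\<lbrakk>A \<in> Obj C; B \<in> Obj C\<rbrakk> \<Longrightarrow> A \<otimes>\<^sub>o B \<in> Obj C"
    and TenA_hom: "\<lbrakk>f \<in> hom C A A'; g \<in> hom C B B'\<rbrakk> \<Longrightarrow> f \<otimes> g \<in> hom C (A \<otimes>\<^sub>o B) (A' \<otimes>\<^sub>o B')"
    and TenA_Idt: "\<lbrakk>A \<in> Obj C; B \<in> Obj C\<rbrakk> \<Longrightarrow> Idt C A \<otimes> Idt C B = Idt C (A \<otimes>\<^sub>o B)"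
    and TenA_Cmp: "\<lbrakk>f \<in> hom C A A'; f' \<in> hom C A' A''; g \<in> hom C B B'; g' \<in> hom C B' B''\<rbrakk>
          \<Longrightarrow> (f' \<cdot> f) \<otimes> (g' \<cdot> g) = (f' \<otimes> g') \<cdot> (f \<otimes> g)"
    and Assoc_hom: "\<lbrakk>A \<in> Obj C; B \<in> Obj C; D \<in> Obj C\<rbrakk>
          \<Longrightarrow> Assoc C A B D \<in> hom C ((A \<otimes>\<^sub>o B) \<otimes>\<^sub>o D) (A \<otimes>\<^sub>o (B \<otimes>\<^sub>o D))"
    and Lun_hom: "A \<in> Obj C \<Longrightarrow> Lun C A \<in> hom C (\<I> \<otimes>\<^sub>o A) A"
    and Run_hom: "A \<in> Obj C \<Longrightarrow> Run C A \<in> hom C (A \<otimes>\<^sub>o \<I>) A"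
    and Braid_hom: "\<lbrakk>A \<in> Obj C; B \<in> Obj C\<rbrakk> \<Longrightarrow> Braid C A B \<in> hom C (A \<otimes>\<^sub>o B) (B \<otimes>\<^sub>o A)"
    and Assoc_iso: "\<lbrakk>A \<in> Obj C; B \<in> Obj C; D \<in> Obj C\<rbrakk> \<Longrightarrow> isomorphism C (Assoc C A B D)"
    and Lun_iso: "A \<in> Obj C \<Longrightarrow> isomorphism C (Lun C A)"
    and Run_iso: "A \<in> Obj C \<Longrightarrow> isomorphism C (Run C A)"
    and Assoc_natural: "\<lbrakk>f \<in> hom C A A'; g \<in> hom C B B'; h \<in> hom C D D'\<rbrakk>
          \<Longrightarrow> Assoc C A' B' D' \<cdot> ((f \<otimes> g) \<otimes> h) = (f \<otimes> (g \<otimes> h)) \<cdot> Assoc C A B D"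
    and Lun_natural: "f \<in> hom C A A' \<Longrightarrow> Lun C A' \<cdot> (Idt C \<I> \<otimes> f) = f \<cdot> Lun C A"
    and Run_natural: "f \<in> hom C A A' \<Longrightarrow> Run C A' \<cdot> (f \<otimes> Idt C \<I>) = f \<cdot> Run C A"
    and Braid_natural: "\<lbrakk>f \<in> hom C A A'; g \<in> hom C B B'\<rbrakk>
          \<Longrightarrow> Braid C A' B' \<cdot> (f \<otimes> g) = (g \<otimes> f) \<cdot> Braid C A B"
    and Braid_symmetric: "\<lbrakk>A \<in> Obj C; B \<in> Obj C\<rbrakk>
          \<Longrightarrow> Braid C B A \<cdot> Braid C A B = Idt C (A \<otimes>\<^sub>o B)"
    and pentagon: "\<lbrakk>A \<in> Obj C; B \<in> Obj C; D \<in> Obj C; E \<in> Obj C\<rbrakk>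
          \<Longrightarrow> (Idt C A \<otimes> Assoc C B D E) \<cdot> Assoc C A (B \<otimes>\<^sub>o D) E \<cdot> (Assoc C A B D \<otimes> Idt C E)
            = Assoc C A B (D \<otimes>\<^sub>o E) \<cdot> Assoc C (A \<otimes>\<^sub>o B) D E"
    and triangle: "\<lbrakk>A \<in> Obj C; B \<in> Obj C\<rbrakk>
          \<Longrightarrow> (Idt C A \<otimes> Lun C B) \<cdot> Assoc C A \<I> B = Run C A \<otimes> Idt C B"
    and hexagon: "\<lbrakk>A \<in> Obj C; B \<in> Obj C; D \<in> Obj C\<rbrakk>
          \<Longrightarrow> Assoc C B D A \<cdot> Braid C A (B \<otimes>\<^sub>o D) \<cdot> Assoc C A B D
            = (Idt C B \<otimes> Braid C A D) \<cdot> Assoc C B A D \<cdot> (Braid C A B \<otimes> Idt C D)"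

locale gs_monoidal_category = symmetric_monoidal_category +
  assumes Copy_hom: "A \<in> Obj C \<Longrightarrow> Copy C A \<in> hom C A (A \<otimes>\<^sub>o A)"
    and Del_hom: "A \<in> Obj C \<Longrightarrow> Del C A \<in> hom C A \<I>"
    and Copy_coassoc: "A \<in> Obj C
          \<Longrightarrow> Assoc C A A A \<cdot> (Copy C A \<otimes> Idt C A) \<cdot> Copy C A = (Idt C A \<otimes> Copy C A) \<cdot> Copy C A"
    and Copy_counit_left: "A \<in> Obj C
          \<Longrightarrow> Lun C A \<cdot> (Del C A \<otimes> Idt C A) \<cdot> Copy C A = Idt C A"
    and Copy_counit_right: "A \<in> Obj C
          \<Longrightarrow> Run C A \<cdot> (Idt C A \<otimes> Del C A) \<cdot> Copy C A = Idt C A"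
    and Copy_cocomm: "A \<in> Obj C \<Longrightarrow> Braid C A A \<cdot> Copy C A = Copy C A"
    and Copy_TenO: "\<lbrakk>A \<in> Obj C; B \<in> Obj C\<rbrakk>
          \<Longrightarrow> Copy C (A \<otimes>\<^sub>o B) = interchange C A A B B \<cdot> (Copy C A \<otimes> Copy C B)"
    and Del_TenO: "\<lbrakk>A \<in> Obj C; B \<in> Obj C\<rbrakk>
          \<Longrightarrow> Del C (A \<otimes>\<^sub>o B) = Lun C \<I> \<cdot> (Del C A \<otimes> Del C B)"
    and Del_Unt: "Del C \<I> = Idt C \<I>"

text \<open>Without strictness, the domain needs a right unitor to be an endomorphism of the source.\<close>

definition domain :: "('o, 'm, 'x) gs_structure_scheme \<Rightarrow> 'm \<Rightarrow> 'm" where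
  "domain C f = Cmp C (Run C (Src C f))
     (Cmp C (TenA C (Idt C (Src C f)) (Cmp C (Del C (Tgt C f)) f)) (Copy C (Src C f)))"

definition normalized :: "('o, 'm, 'x) gs_structure_scheme \<Rightarrow> 'm \<Rightarrow> bool" where
  "normalized C f \<longleftrightarrow> Cmp C f (domain C f) = f"


section \<open>Lax gs-monoidal functors to Rel\<close>

text \<open>
  Relations \<open>X \<rightarrow> Y\<close> between sets are subsets of \<open>X \<times> Y\<close>. A composite that is written \<open>S \<circ> R\<close> in
  applicative order is \<open>R O S\<close>. The tensor product and its structure in Rel are given by the
  cartesian product of HOL types, with the type \<open>unit\<close> as unit.
\<close>

definition rel_ten :: "('a \<times> 'b) set \<Rightarrow> ('c \<times> 'd) set \<Rightarrow> (('a \<times> 'c) \<times> ('b \<times> 'd)) set" where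
  "rel_ten R S = {((a, c), (b, d)) | a b c d. (a, b) \<in> R \<and> (c, d) \<in> S}"

definition rel_assoc ::
    "'a set \<Rightarrow> 'b set \<Rightarrow> 'c set \<Rightarrow> ((('a \<times> 'b) \<times> 'c) \<times> ('a \<times> ('b \<times> 'c))) set" where
  "rel_assoc X Y Z = {(((x, y), z), (x, (y, z))) | x y z. x \<in> X \<and> y \<in> Y \<and> z \<in> Z}"

definition rel_lun :: "'a set \<Rightarrow> ((unit \<times> 'a) \<times> 'a) set" where
  "rel_lun X = {(((), x), x) | x. x \<in> X}"

definition rel_run :: "'a set \<Rightarrow> (('a \<times> unit) \<times> 'a) set" where
  "rel_run X = {((x, ()), x) | x. x \<in> X}"

definition rel_braid :: "'a set \<Rightarrow> 'b set \<Rightarrow> (('a \<times> 'b) \<times> ('b \<times> 'a)) set" where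
  "rel_braid X Y = {((x, y), (y, x)) | x y. x \<in> X \<and> y \<in> Y}"

definition rel_copy :: "'a set \<Rightarrow> ('a \<times> ('a \<times> 'a)) set" where
  "rel_copy X = {(x, (x, x)) | x. x \<in> X}"

definition rel_del :: "'a set \<Rightarrow> ('a \<times> unit) set" where
  "rel_del X = {(x, ()) | x. x \<in> X}"

text \<open>
  Action on objects and arrows, and the structure maps \<open>\<psi>\<^sub>0 : 1 \<rightarrow> \<Phi> I\<close> and
  \<open>\<psi>\<^sub>A\<^sub>,\<^sub>B : \<Phi> A \<times> \<Phi> B \<rightarrow> \<Phi> (A \<otimes> B)\<close>. The type \<open>'s\<close> is one ambient universe containing all
  the sets \<open>\<Phi> A\<close>.
\<close>

record ('o, 'm, 's) rel_functor =
  FO   :: "'o \<Rightarrow> 's set"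
  FA   :: "'m \<Rightarrow> ('s \<times> 's) set"
  Psi0 :: "(unit \<times> 's) set"
  Psi  :: "'o \<Rightarrow> 'o \<Rightarrow> (('s \<times> 's) \<times> 's) set"

locale lax_symmetric_monoidal_functor_Rel = symmetric_monoidal_category C
  for C :: "('o, 'm, 'x) gs_structure_scheme" (structure) +
  fixes \<Phi> :: "('o, 'm, 's, 'y) rel_functor_scheme"
  assumes FA_hom: "f \<in> hom C A B \<Longrightarrow> FA \<Phi> f \<subseteq> FO \<Phi> A \<times> FO \<Phi> B"
    and FA_Idt: "A \<in> Obj C \<Longrightarrow> FA \<Phi> (Idt C A) = Id_on (FO \<Phi> A)"
    and FA_Cmp: "\<lbrakk>f \<in> hom C A B; g \<in> hom C B D\<rbrakk> \<Longrightarrow> FA \<Phi> (g \<cdot> f) = FA \<Phi> f O FA \<Phi> g"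
    and Psi0_hom: "Psi0 \<Phi> \<subseteq> UNIV \<times> FO \<Phi> \<I>"
    and Psi_hom: "\<lbrakk>A \<in> Obj C; B \<in> Obj C\<rbrakk>
          \<Longrightarrow> Psi \<Phi> A B \<subseteq> (FO \<Phi> A \<times> FO \<Phi> B) \<times> FO \<Phi> (A \<otimes>\<^sub>o B)"
    and Psi_natural: "\<lbrakk>f \<in> hom C A A'; g \<in> hom C B B'\<rbrakk>
          \<Longrightarrow> rel_ten (FA \<Phi> f) (FA \<Phi> g) O Psi \<Phi> A' B' = Psi \<Phi> A B O FA \<Phi> (f \<otimes> g)"
    and Psi_assoc: "\<lbrakk>A \<in> Obj C; B \<in> Obj C; D \<in> Obj C\<rbrakk>
          \<Longrightarrow> rel_ten (Psi \<Phi> A B) (Id_on (FO \<Phi> D)) O Psi \<Phi> (A \<otimes>\<^sub>o B) D O FA \<Phi> (Assoc C A B D)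
            = rel_assoc (FO \<Phi> A) (FO \<Phi> B) (FO \<Phi> D)
                O rel_ten (Id_on (FO \<Phi> A)) (Psi \<Phi> B D) O Psi \<Phi> A (B \<otimes>\<^sub>o D)"
    and Psi_lunit: "A \<in> Obj C
          \<Longrightarrow> rel_ten (Psi0 \<Phi>) (Id_on (FO \<Phi> A)) O Psi \<Phi> \<I> A O FA \<Phi> (Lun C A)
            = rel_lun (FO \<Phi> A)"
    and Psi_runit: "A \<in> Obj C
          \<Longrightarrow> rel_ten (Id_on (FO \<Phi> A)) (Psi0 \<Phi>) O Psi \<Phi> A \<I> O FA \<Phi> (Run C A)
            = rel_run (FO \<Phi> A)"
    and Psi_braid: "\<lbrakk>A \<in> Obj C; B \<in> Obj C\<rbrakk>
          \<Longrightarrow> Psi \<Phi> A B O FA \<Phi> (Braid C A B) = rel_braid (FO \<Phi> A) (FO \<Phi> B) O Psi \<Phi> B A"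

locale lax_gs_monoidal_functor_Rel =
  gs_monoidal_category C + lax_symmetric_monoidal_functor_Rel C \<Phi>
  for C :: "('o, 'm, 'x) gs_structure_scheme" (structure)
    and \<Phi> :: "('o, 'm, 's, 'y) rel_functor_scheme" +
  assumes FA_Copy: "A \<in> Obj C \<Longrightarrow> FA \<Phi> (Copy C A) = rel_copy (FO \<Phi> A) O Psi \<Phi> A A"
    and FA_Del: "A \<in> Obj C \<Longrightarrow> FA \<Phi> (Del C A) = rel_del (FO \<Phi> A) O Psi0 \<Phi>"


section \<open>Imitation and target--context categories\<close>

text \<open>
  For a preorder given as a set \<open>r\<close> of pairs, \<open>(u, v) \<in> r\<close> stands for \<open>u \<succeq> v\<close>.
  The relation below is \<open>\<nu> \<succeq> \<mu>\<close> for relations with source \<open>X\<close>.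
\<close>

definition imitates :: "'a set \<Rightarrow> ('b \<times> 'b) set \<Rightarrow> ('a \<times> 'b) set \<Rightarrow> ('a \<times> 'b) set \<Rightarrow> bool" where
  "imitates X r \<nu> \<mu> \<longleftrightarrow>
     (\<forall>a\<in>X. \<mu> `` {a} \<noteq> {} \<longrightarrow>
        (\<exists>enh \<in> \<mu> `` {a} \<rightarrow> \<nu> `` {a}. \<forall>u \<in> \<mu> `` {a}. (enh u, u) \<in> r) \<and>
        (\<exists>deg \<in> \<nu> `` {a} \<rightarrow> \<mu> `` {a}. \<forall>v \<in> \<nu> `` {a}. (v, deg v) \<in> r))"

text \<open>A relation \<open>R : X \<rightarrow> Y\<close> that is (the graph of) a function.\<close>

definition functional_rel :: "'a set \<Rightarrow> 'b set \<Rightarrow> ('a \<times> 'b) set \<Rightarrow> bool" where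
  "functional_rel X Y R \<longleftrightarrow> R \<subseteq> X \<times> Y \<and> (\<forall>x\<in>X. \<exists>!y. (x, y) \<in> R)"

text \<open>
  The ambient imitation relation \<open>f \<succeq> g\<close> on arrows \<open>f, g : A \<rightarrow> T \<otimes> K\<close>, depending on the evaluation
  function (as a relation) and the preorder on behaviors.
\<close>

definition ambient_imitation :: "('o, 'm, 's, 'y) rel_functor_scheme \<Rightarrow> ('s \<times> 'b) set
    \<Rightarrow> ('b \<times> 'b) set \<Rightarrow> 'o \<Rightarrow> 'm \<Rightarrow> 'm \<Rightarrow> bool" where
  "ambient_imitation \<Phi> ev geB A f g \<longleftrightarrow>
     imitates (FO \<Phi> A) geB (FA \<Phi> f O ev) (FA \<Phi> g O ev)"

locale target_context_category_with_behaviors = lax_gs_monoidal_functor_Rel C \<Phi>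
  for C :: "('o, 'm, 'x) gs_structure_scheme" (structure)
    and T K :: 'o
    and \<Phi> :: "('o, 'm, 's, 'y) rel_functor_scheme"
    and Bbar :: "'b set"
    and ev :: "('s \<times> 'b) set"
    and geB :: "('b \<times> 'b) set" +
  assumes all_normalized: "f \<in> Arr C \<Longrightarrow> normalized C f"
    and T_Obj: "T \<in> Obj C"
    and K_Obj: "K \<in> Obj C"
    and geB_preorder: "preorder_on Bbar geB"
    and ev_function: "functional_rel (FO \<Phi> (T \<otimes>\<^sub>o K)) Bbar ev"
    and ambient_domain: "\<lbrakk>f \<in> hom C A (T \<otimes>\<^sub>o K); g \<in> hom C A (T \<otimes>\<^sub>o K); f \<cdot> domain C g = g\<rbrakk>
          \<Longrightarrow> ambient_imitation \<Phi> ev geB A f g"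
    and ambient_precomp: "\<lbrakk>f \<in> hom C A (T \<otimes>\<^sub>o K); g \<in> hom C A (T \<otimes>\<^sub>o K);
          ambient_imitation \<Phi> ev geB A f g; h \<in> hom C Z A\<rbrakk>
          \<Longrightarrow> ambient_imitation \<Phi> ev geB Z (f \<cdot> h) (g \<cdot> h)"

text \<open>
  Intrinsic behaviors: the set of behaviors is \<open>\<Phi> B\<close> and the evaluation function is \<open>\<Phi> eval\<close>.
  In particular the relation \<open>\<Phi> eval\<close> is required to be a function.
\<close>

locale target_context_category_with_intrinsic_behaviors =
  target_context_category_with_behaviors C T K \<Phi> "FO \<Phi> B" "FA \<Phi> eval" geB
  for C :: "('o, 'm, 'x) gs_structure_scheme" (structure)
    and T K :: 'o
    and \<Phi> :: "('o, 'm, 's, 'y) rel_functor_scheme"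
    and B :: 'o
    and eval :: 'm
    and geB :: "('s \<times> 's) set" +
  assumes B_Obj: "B \<in> Obj C"
    and eval_hom: "eval \<in> hom C (T \<otimes>\<^sub>o K) B"

end

(* The object of behaviors can be taken to be T \<otimes> K, with the identity as evaluation, if
   u is declared at least as good as v whenever ev u is at least as good as ev v. Since ev is a
   function, enhancement and degradation maps transport along it in both directions, so this does
   not change the ambient imitation relation at all. *)
theory Submission
  imports Defs
begin

text \<open>A form of the axiom of choice, used to trade the functions \<open>enh\<close> and
  \<open>deg\<close> for pointwise existence.\<close>

lemma bchoice_Pi_iff: "(\<exists>h \<in> A \<rightarrow> B. \<forall>x\<in>A. P x (h x)) \<longleftrightarrow> (\<forall>x\<in>A. \<exists>y\<in>B. P x y)"
proof
  assume "\<forall>x\<in>A. \<exists>y\<in>B. P x y"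
  then obtain h where "\<forall>x\<in>A. h x \<in> B \<and> P x (h x)"
    by metis
  then show "\<exists>h \<in> A \<rightarrow> B. \<forall>x\<in>A. P x (h x)"
    by blast
qed auto

text \<open>The pointwise form is the one that transports along a map \<open>e\<close>: a given
  \<open>enh\<close> need not be constant on the fibres of \<open>e\<close>, so it does not directly
  descend to the image.\<close>

lemma imitates_iff:
  "imitates X r \<nu> \<mu> \<longleftrightarrow>
     (\<forall>a\<in>X. \<mu> `` {a} \<noteq> {} \<longrightarrow>
        (\<forall>u \<in> \<mu> `` {a}. \<exists>v \<in> \<nu> `` {a}. (v, u) \<in> r) \<and>
        (\<forall>v \<in> \<nu> `` {a}. \<exists>u \<in> \<mu> `` {a}. (v, u) \<in> r))"
  unfolding imitates_def
  by (simp only: bchoice_Pi_iff[where P = "\<lambda>u v. (v, u) \<in> r"]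
      bchoice_Pi_iff[where P = "\<lambda>v u. (v, u) \<in> r"])

text \<open>With \<open>ev\<close> the graph of \<open>e\<close>, the values on the right are the
  \<open>e\<close>-images of those on the left, and the pulled back order compares exactly these
  images. Images preserve and reflect emptiness.\<close>

lemma imitates_pullback:
  assumes ev: "functional_rel Y Z ev" and "\<nu> \<subseteq> X \<times> Y" "\<mu> \<subseteq> X \<times> Y"
  shows "imitates X (ev O r O ev\<inverse>) \<nu> \<mu> \<longleftrightarrow> imitates X r (\<nu> O ev) (\<mu> O ev)"
proof -
  from ev have ev_sub: "ev \<subseteq> Y \<times> Z" and ev_ex1: "\<forall>y\<in>Y. \<exists>!z. (y, z) \<in> ev"
    by (simp_all add: functional_rel_def)
  from ev_ex1 obtain e where "\<forall>y\<in>Y. (y, e y) \<in> ev"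
    by metis
  with ev_sub ev_ex1 have e: "ev = {(y, e y) | y. y \<in> Y}"
    by blast
  have *: "(R O ev) `` {a} = e ` (R `` {a})" if "R \<subseteq> X \<times> Y" for R a
    using that unfolding e by auto
  have **: "(v, u) \<in> ev O r O ev\<inverse> \<longleftrightarrow> (e v, e u) \<in> r" if "u \<in> Y" "v \<in> Y" for u v
    using that unfolding e by auto
  have mem: "\<And>a y. y \<in> \<nu> `` {a} \<Longrightarrow> y \<in> Y" "\<And>a y. y \<in> \<mu> `` {a} \<Longrightarrow> y \<in> Y"
    using assms(2,3) by auto
  show ?thesis
    unfolding imitates_iff *[OF assms(2)] *[OF assms(3)]
    \<comment> \<open>The congruence rules supply the memberships that \<open>mem\<close> turns into
      the side conditions of \<open>**\<close>; \<open>Image_singleton_iff\<close> is removed so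
      that \<open>mem\<close> still matches.\<close>
    by (simp add: ** mem del: Image_singleton_iff cong: ball_cong bex_cong)
qed

text \<open>Reflexivity comes from totality of \<open>ev\<close>. Transitivity comes from its
  single-valuedness, which identifies the two values in \<open>Z\<close> of the middle
  element.\<close>

lemma preorder_on_pullback:
  assumes "functional_rel Y Z ev" and "preorder_on Z r"
  shows "preorder_on Y (ev O r O ev\<inverse>)"
proof -
  have ev: "ev \<subseteq> Y \<times> Z" "\<And>y. y \<in> Y \<Longrightarrow> \<exists>z. (y, z) \<in> ev"
      "\<And>y z z'. (y, z) \<in> ev \<Longrightarrow> (y, z') \<in> ev \<Longrightarrow> z = z'"
    using assms(1) unfolding functional_rel_def by blast+
  have r: "refl_on Z r" "trans r"
    using assms(2) by (auto simp: preorder_on_def)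
  have "refl_on Y (ev O r O ev\<inverse>)"
    using ev(1,2) r(1) unfolding refl_on_def by fast
  moreover have "trans (ev O r O ev\<inverse>)"
    using ev(3) r(2) unfolding trans_def by blast
  ultimately show ?thesis
    using ev(1) by (auto simp: preorder_on_def)
qed

context target_context_category_with_behaviors
begin

lemma ambient_imitation_pullback:
  assumes "f \<in> hom C A (T \<otimes>\<^sub>o K)" "g \<in> hom C A (T \<otimes>\<^sub>o K)"
  shows "ambient_imitation \<Phi> (FA \<Phi> (Idt C (T \<otimes>\<^sub>o K))) (ev O geB O ev\<inverse>) A f g
    \<longleftrightarrow> ambient_imitation \<Phi> ev geB A f g"
proof -
  note sub = FA_hom[OF assms(1)] FA_hom[OF assms(2)]
  \<comment> \<open>By functoriality the new evaluation is the identity relation, so it drops out of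
    both composites.\<close>
  have "R O Id_on (FO \<Phi> (T \<otimes>\<^sub>o K)) = R" if "R \<subseteq> FO \<Phi> A \<times> FO \<Phi> (T \<otimes>\<^sub>o K)" for R
    using that by auto
  with sub show ?thesis
    by (simp add: ambient_imitation_def FA_Idt TenO_Obj T_Obj K_Obj imitates_pullback[OF ev_function])
qed

lemma intrinsic_pullback:
  "target_context_category_with_intrinsic_behaviors C T K \<Phi>
     (T \<otimes>\<^sub>o K) (Idt C (T \<otimes>\<^sub>o K)) (ev O geB O ev\<inverse>)"
proof
  show "preorder_on (FO \<Phi> (T \<otimes>\<^sub>o K)) (ev O geB O ev\<inverse>)"
    using ev_function geB_preorder by (rule preorder_on_pullback)
  show "functional_rel (FO \<Phi> (T \<otimes>\<^sub>o K)) (FO \<Phi> (T \<otimes>\<^sub>o K)) (FA \<Phi> (Idt C (T \<otimes>\<^sub>o K)))"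
    by (auto simp: FA_Idt TenO_Obj T_Obj K_Obj functional_rel_def)
  show "ambient_imitation \<Phi> (FA \<Phi> (Idt C (T \<otimes>\<^sub>o K))) (ev O geB O ev\<inverse>) A f g"
    if "f \<in> hom C A (T \<otimes>\<^sub>o K)" "g \<in> hom C A (T \<otimes>\<^sub>o K)" "f \<cdot> domain C g = g" for f g A
    using that by (simp add: ambient_imitation_pullback ambient_domain)
  show "ambient_imitation \<Phi> (FA \<Phi> (Idt C (T \<otimes>\<^sub>o K))) (ev O geB O ev\<inverse>) Z (f \<cdot> h) (g \<cdot> h)"
    if "f \<in> hom C A (T \<otimes>\<^sub>o K)" "g \<in> hom C A (T \<otimes>\<^sub>o K)"
      "ambient_imitation \<Phi> (FA \<Phi> (Idt C (T \<otimes>\<^sub>o K))) (ev O geB O ev\<inverse>) A f g"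
      "h \<in> hom C Z A" for f g h A Z
    \<comment> \<open>The equivalence is used twice: at \<open>A\<close> for the hypothesis, at
      \<open>Z\<close> for the composites.\<close>
    using that ambient_precomp[of f A g h Z]
    by (simp add: ambient_imitation_pullback Cmp_hom[OF that(4)])
qed (simp_all add: all_normalized T_Obj K_Obj TenO_Obj Idt_hom)

end

theorem mainTheorem17:
  fixes C :: "('o, 'm) gs_structure"
    and T K :: 'o
    and \<Phi> :: "('o, 'm, 's) rel_functor"
    and Bbar :: "'b set"
    and ev :: "('s \<times> 'b) set"
    and geB :: "('b \<times> 'b) set"
  assumes "target_context_category_with_behaviors C T K \<Phi> Bbar ev geB"
  shows "\<exists>(B_intr :: 'o) (eval_intr :: 'm) (geB' :: ('s \<times> 's) set).
    target_context_category_with_intrinsic_behaviors C T K \<Phi> B_intr eval_intr geB' \<and>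
    (\<forall>A \<in> Obj C. \<forall>f \<in> hom C A (TenO C T K). \<forall>g \<in> hom C A (TenO C T K).
       ambient_imitation \<Phi> (FA \<Phi> eval_intr) geB' A f g \<longrightarrow> ambient_imitation \<Phi> ev geB A f g)"
proof -
  interpret target_context_category_with_behaviors C T K \<Phi> Bbar ev geB
    by (fact assms)
  show ?thesis
    using intrinsic_pullback ambient_imitation_pullback by blast
qed

end
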